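(* Let $X$ be a path-connected metric space, $x_0\in X$, and let $N\leq H\leq\pi_1(X,x_0)$ be subgroups, where $N$ is a normal subgroup of $\pi_1(X,x_0)$ and $p_N:\widetilde{X}_N\to X$ has the unique path lifting property. If for every point $x\in X$ there is an open neighborhood $U$ of $x$ in $X$ such that $\pi(x,U)\cap H\leq N$, then $p_H:\widetilde{X}_H\to X$ has the unique path lifting property.
   Context: For paths, $\alpha\cdot\beta$ is concatenation and $\alpha^{-}(t)=\alpha(1-t)$. For $x\in X$ and an open neighborhood $U$ of $x$, $\pi(x,U)\leq\pi_1(X,x_0)$ is the subgroup generated by all elements $[\alpha\cdot\delta\cdot\alpha^{-}]$, where $\alpha$ is a path in $X$ from $x_0$ to $x$ and $\delta$ is a loop in $U$ based at $x$ (it is a normal subgroup). For a subgroup $K\leq\pi_1(X,x_0)$, $\widetilde{X}_K$ is the set of equivalence classes $K[\alpha]$ of paths $\alpha:[0,1]\to X$ with $\alpha(0)=x_0$, where $\alpha\sim\beta$ iff $\alpha(1)=\beta(1)$ and $[\alpha\cdot\beta^{-}]\in K$, with the topology generated by the sets $B(K[\alpha],U)=\{K[\alpha\cdot\epsilon]\mid\epsilon:[0,1]\to U\text{ a path},\ \epsilon(0)=\alpha(1)\}$, $U$ an open neighborhood of $\alpha(1)$ in $X$. The map $p_K:\widetilde{X}_K\to X$ is $p_K(K[\alpha])=\alpha(1)$. A continuous map $f:Y\to X$ has the unique path lifting property if whenever $\alpha,\beta:[0,1]\to Y$ are paths with $\alpha(0)=\beta(0)$ and $f\circ\alpha=f\circ\beta$,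 then $\alpha=\beta$. *)

theory Defs
  imports "HOL-Analysis.Analysis" "HOL-Algebra.Generated_Groups"
begin

section \<open>The fundamental group\<close>

text \<open>
  A path is a function on all of \<open>real\<close> of which only the restriction to \<open>{0..1}\<close> matters;
  the relation \<^const>\<open>homotopic_paths\<close> ignores the values outside \<open>{0..1}\<close>.
\<close>

definition homotopy_class :: "'a::topological_space set \<Rightarrow> (real \<Rightarrow> 'a) \<Rightarrow> (real \<Rightarrow> 'a) set" where
  "homotopy_class X p = {q. homotopic_paths X p q}"

definition paths_from :: "'a::topological_space set \<Rightarrow> 'a \<Rightarrow> (real \<Rightarrow> 'a) set" where
  "paths_from X x = {p. path p \<and> path_image p \<subseteq> X \<and> pathstart p = x}"

definition loops_at :: "'a::topological_space set \<Rightarrow> 'a \<Rightarrow> (real \<Rightarrow> 'a) set" where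
  "loops_at X x = {p \<in> paths_from X x. pathfinish p = x}"

definition fundamental_group :: "'a::topological_space set \<Rightarrow> 'a \<Rightarrow> (real \<Rightarrow> 'a) set monoid" where
  "fundamental_group X x0 =
    \<lparr>carrier = homotopy_class X ` loops_at X x0,
     monoid.mult = (\<lambda>A B. {r. \<exists>p\<in>A. \<exists>q\<in>B. homotopic_paths X (p +++ q) r}),
     one = homotopy_class X (\<lambda>_. x0)\<rparr>"

definition pi_nbhd :: "'a::topological_space set \<Rightarrow> 'a \<Rightarrow> 'a \<Rightarrow> 'a set \<Rightarrow> (real \<Rightarrow> 'a) set set" where
  "pi_nbhd X x0 x U =
    generate (fundamental_group X x0)
      {homotopy_class X (\<alpha> +++ \<delta> +++ reversepath \<alpha>) |\<alpha> \<delta>.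
         \<alpha> \<in> paths_from X x0 \<and> pathfinish \<alpha> = x \<and> \<delta> \<in> loops_at U x}"


section \<open>The space of path classes modulo a subgroup\<close>

text \<open>The class \<open>K[\<alpha>]\<close>.\<close>

definition coset_class ::
    "'a::topological_space set \<Rightarrow> 'a \<Rightarrow> (real \<Rightarrow> 'a) set set \<Rightarrow> (real \<Rightarrow> 'a) \<Rightarrow> (real \<Rightarrow> 'a) set" where
  "coset_class X x0 K \<alpha> =
    {\<beta> \<in> paths_from X x0. pathfinish \<alpha> = pathfinish \<beta> \<and> homotopy_class X (\<alpha> +++ reversepath \<beta>) \<in> K}"

definition basic_nbhd ::
    "'a::topological_space set \<Rightarrow> 'a \<Rightarrow> (real \<Rightarrow> 'a) set set \<Rightarrow> (real \<Rightarrow> 'a) \<Rightarrow> 'a set \<Rightarrow> (real \<Rightarrow> 'a) set set" where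
  "basic_nbhd X x0 K \<alpha> U =
    {coset_class X x0 K (\<alpha> +++ \<epsilon>) |\<epsilon>. \<epsilon> \<in> paths_from U (pathfinish \<alpha>)}"

text \<open>
  The underlying set of this topology is \<open>coset_class X x0 K ` paths_from X x0\<close>;
  see \<open>topspace_tilde_space\<close> below.
\<close>

definition tilde_space ::
    "'a::topological_space set \<Rightarrow> 'a \<Rightarrow> (real \<Rightarrow> 'a) set set \<Rightarrow> (real \<Rightarrow> 'a) set topology" where
  "tilde_space X x0 K =
    topology_generated_by
      {basic_nbhd X x0 K \<alpha> U |\<alpha> U.
         \<alpha> \<in> paths_from X x0 \<and> openin (top_of_set X) U \<and> pathfinish \<alpha> \<in> U}"

text \<open>All members of a class have the same endpoint, so the image below is a singleton.\<close>

definition endpoint_map :: "(real \<Rightarrow> 'a::topological_space) set \<Rightarrow> 'a" where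
  "endpoint_map c = the_elem (pathfinish ` c)"


section \<open>Unique path lifting\<close>

definition unique_path_lifting :: "'b topology \<Rightarrow> 'a topology \<Rightarrow> ('b \<Rightarrow> 'a) \<Rightarrow> bool" where
  "unique_path_lifting Y X f \<longleftrightarrow>
    continuous_map Y X f \<and>
    (\<forall>\<alpha> \<beta>. pathin Y \<alpha> \<longrightarrow> pathin Y \<beta> \<longrightarrow> \<alpha> 0 = \<beta> 0 \<longrightarrow>
       (\<forall>t\<in>{0..1}. f (\<alpha> t) = f (\<beta> t)) \<longrightarrow> (\<forall>t\<in>{0..1}. \<alpha> t = \<beta> t))"


section \<open>Basic facts\<close>

text \<open>
  The library states the unit and inverse laws for \<^const>\<open>homotopic_paths\<close> only in normed
  spaces, because it writes constant paths as \<^const>\<open>linepath\<close>.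
\<close>

lemma homotopic_paths_const_right:
  assumes "path p" "path_image p \<subseteq> X" "pathfinish p = x"
  shows "homotopic_paths X (p +++ (\<lambda>_. x)) p"
proof (rule homotopic_paths_sym, rule homotopic_paths_reparametrize[where f = "\<lambda>t. min 1 (2 * t)"])
  show "continuous_on {0..1} (\<lambda>t::real. min 1 (2 * t))" by (intro continuous_intros)
  show "(p +++ (\<lambda>_. x)) t = p (min 1 (2 * t))" if "t \<in> {0..1}" for t
  proof (cases "t = 1/2")
    case True
    show ?thesis unfolding True using assms(3) by (simp add: joinpaths_def pathfinish_def min_def)
  next
    case False
    then show ?thesis using assms(3) by (auto simp: joinpaths_def pathfinish_def min_def)
  qed
qed (use assms in auto)

lemma homotopic_paths_const_left:
  assumes "path p" "path_image p \<subseteq> X" "pathstart p = x"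
  shows "homotopic_paths X ((\<lambda>_. x) +++ p) p"
proof (rule homotopic_paths_sym, rule homotopic_paths_reparametrize[where f = "\<lambda>t. max 0 (2 * t - 1)"])
  show "continuous_on {0..1} (\<lambda>t::real. max 0 (2 * t - 1))" by (intro continuous_intros)
  show "((\<lambda>_. x) +++ p) t = p (max 0 (2 * t - 1))" if "t \<in> {0..1}" for t
  proof (cases "t = 1/2")
    case True
    show ?thesis unfolding True using assms(3) by (simp add: joinpaths_def pathstart_def max_def)
  next
    case False
    then show ?thesis using assms(3) by (auto simp: joinpaths_def pathstart_def max_def)
  qed
qed (use assms in auto)

lemma homotopic_paths_inverse_right:
  assumes "path p" "path_image p \<subseteq> X" "pathstart p = x"
  shows "homotopic_paths X (p +++ reversepath p) (\<lambda>_. x)"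
proof -
  let ?f = "\<lambda>z::real\<times>real. (1 - fst z) * (1 - \<bar>2 * snd z - 1\<bar>)"
  have f: "?f z \<in> {0..1}" if "z \<in> {0..1} \<times> {0..1}" for z
  proof -
    have "\<bar>2 * snd z - 1\<bar> \<le> 1" using that by (auto simp: abs_if)
    then show ?thesis using that by (auto intro: mult_le_one)
  qed
  have p: "continuous_on {0..1} p" "\<And>t. t \<in> {0..1} \<Longrightarrow> p t \<in> X"
    using assms by (auto simp: path_def path_image_def)
  have "continuous_on ({0..1} \<times> {0..1}) (p \<circ> ?f)"
    by (intro continuous_on_compose continuous_intros continuous_on_subset[OF p(1)])
      (use f in blast)
  moreover have "p \<circ> ?f \<in> ({0..1} \<times> {0..1}) \<rightarrow> X"
    using f p(2) by (auto simp del: atLeastAtMost_iff)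
  ultimately show ?thesis
    unfolding homotopic_paths using assms(3)
    by (intro exI[of _ "p \<circ> ?f"])
      (auto simp: joinpaths_def reversepath_def pathstart_def pathfinish_def algebra_simps)
qed

lemma paths_from_const: "x \<in> X \<Longrightarrow> (\<lambda>_. x) \<in> paths_from X x"
  by (auto simp: paths_from_def path_def path_image_def pathstart_def)

lemma homotopy_class_eq:
  assumes "homotopic_paths X p q"
  shows "homotopy_class X p = homotopy_class X q"
  using assms unfolding homotopy_class_def
  by (blast intro: homotopic_paths_trans homotopic_paths_sym)

lemma homotopy_class_eq_iff:
  assumes "path p" "path_image p \<subseteq> X"
  shows "homotopy_class X p = homotopy_class X q \<longleftrightarrow> homotopic_paths X p q"
proof
  assume "homotopy_class X p = homotopy_class X q"
  moreover have "p \<in> homotopy_class X p" using assms by (simp add: homotopy_class_def)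
  ultimately show "homotopic_paths X p q"
    by (simp add: homotopy_class_def homotopic_paths_sym)
qed (rule homotopy_class_eq)

lemma fundamental_group_mult:
  assumes "p \<in> loops_at X x0" "q \<in> loops_at X x0"
  shows "homotopy_class X p \<otimes>\<^bsub>fundamental_group X x0\<^esub> homotopy_class X q = homotopy_class X (p +++ q)"
proof -
  have *: "path p" "path_image p \<subseteq> X" "path q" "path_image q \<subseteq> X" "pathfinish p = pathstart q"
    using assms by (auto simp: loops_at_def paths_from_def)
  have "homotopic_paths X (p +++ q) r"
    if "homotopic_paths X p p'" "homotopic_paths X q q'" "homotopic_paths X (p' +++ q') r" for p' q' r
    using homotopic_paths_join[OF that(1,2) *(5)] that(3) by (rule homotopic_paths_trans)
  moreover have "homotopic_paths X p p" "homotopic_paths X q q" using * by simp_all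
  ultimately show ?thesis
    unfolding fundamental_group_def homotopy_class_def by (simp, blast)
qed

lemma loops_at_join: "p \<in> loops_at X x \<Longrightarrow> q \<in> loops_at X x \<Longrightarrow> p +++ q \<in> loops_at X x"
  by (auto simp: loops_at_def paths_from_def simp: path_image_join)

lemma loops_at_reversepath: "p \<in> loops_at X x \<Longrightarrow> reversepath p \<in> loops_at X x"
  by (auto simp: loops_at_def paths_from_def)

lemma loops_at_const: "x \<in> X \<Longrightarrow> (\<lambda>_. x) \<in> loops_at X x"
  using paths_from_const[of x X] by (simp add: loops_at_def pathfinish_def)

lemma group_fundamental_group:
  assumes "x0 \<in> X"
  shows "group (fundamental_group X x0)" (is "group ?G")
proof (rule groupI)
  have C: "carrier ?G = homotopy_class X ` loops_at X x0"
    and one: "\<one>\<^bsub>?G\<^esub> = homotopy_class X (\<lambda>_. x0)"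
    by (auto simp: fundamental_group_def)
  show "\<one>\<^bsub>?G\<^esub> \<in> carrier ?G"
    using loops_at_const[OF assms] by (auto simp: C one)
  fix a assume "a \<in> carrier ?G"
  then obtain p where p: "p \<in> loops_at X x0" "a = homotopy_class X p" by (auto simp: C)
  then have pp: "path p" "path_image p \<subseteq> X" "pathstart p = x0" "pathfinish p = x0"
    by (auto simp: loops_at_def paths_from_def)
  show "\<one>\<^bsub>?G\<^esub> \<otimes>\<^bsub>?G\<^esub> a = a"
    using homotopic_paths_const_left[OF pp(1-3)]
    by (simp add: one p fundamental_group_mult loops_at_const[OF assms] homotopy_class_eq)
  have "homotopic_paths X (reversepath p +++ p) (\<lambda>_. x0)"
    using homotopic_paths_inverse_right[of "reversepath p" X x0] pp by simp
  then show "\<exists>b\<in>carrier ?G. b \<otimes>\<^bsub>?G\<^esub> a = \<one>\<^bsub>?G\<^esub>"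
    using p by (intro bexI[of _ "homotopy_class X (reversepath p)"])
      (auto simp: C one fundamental_group_mult loops_at_reversepath homotopy_class_eq)
  fix b assume "b \<in> carrier ?G"
  then obtain q where q: "q \<in> loops_at X x0" "b = homotopy_class X q" by (auto simp: C)
  show "a \<otimes>\<^bsub>?G\<^esub> b \<in> carrier ?G"
    using p q by (auto simp: C fundamental_group_mult loops_at_join)
  fix c assume "c \<in> carrier ?G"
  then obtain r where r: "r \<in> loops_at X x0" "c = homotopy_class X r" by (auto simp: C)
  have "homotopic_paths X (p +++ q +++ r) ((p +++ q) +++ r)"
    using p(1) q(1) r(1) by (intro homotopic_paths_assoc) (auto simp: loops_at_def paths_from_def)
  then show "a \<otimes>\<^bsub>?G\<^esub> b \<otimes>\<^bsub>?G\<^esub> c = a \<otimes>\<^bsub>?G\<^esub> (b \<otimes>\<^bsub>?G\<^esub> c)"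
    using p q r by (simp add: fundamental_group_mult loops_at_join homotopy_class_eq)
qed

lemma coset_class_refl:
  assumes "subgroup K (fundamental_group X x0)" "\<alpha> \<in> paths_from X x0"
  shows "\<alpha> \<in> coset_class X x0 K \<alpha>"
proof -
  have "homotopy_class X (\<alpha> +++ reversepath \<alpha>) = homotopy_class X (\<lambda>_. x0)"
    using assms(2) by (intro homotopy_class_eq homotopic_paths_inverse_right) (auto simp: paths_from_def)
  moreover have "\<one>\<^bsub>fundamental_group X x0\<^esub> \<in> K" using assms(1) by (rule subgroup.one_closed)
  ultimately show ?thesis using assms(2) by (simp add: coset_class_def fundamental_group_def)
qed

lemma coset_class_homotopic:
  assumes "homotopic_paths X \<alpha> \<beta>"
  shows "coset_class X x0 K \<alpha> = coset_class X x0 K \<beta>"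
proof -
  have fin: "pathfinish \<alpha> = pathfinish \<beta>" by (rule homotopic_paths_imp_pathfinish[OF assms])
  have "homotopy_class X (\<alpha> +++ reversepath \<gamma>) = homotopy_class X (\<beta> +++ reversepath \<gamma>)"
    if "\<gamma> \<in> paths_from X x0" "pathfinish \<beta> = pathfinish \<gamma>" for \<gamma>
    using that fin by (intro homotopy_class_eq homotopic_paths_join assms) (auto simp: paths_from_def)
  then show ?thesis unfolding coset_class_def using fin by auto
qed

lemma endpoint_map_coset_class:
  assumes "subgroup K (fundamental_group X x0)" "\<alpha> \<in> paths_from X x0"
  shows "endpoint_map (coset_class X x0 K \<alpha>) = pathfinish \<alpha>"
proof -
  have "pathfinish ` coset_class X x0 K \<alpha> = {pathfinish \<alpha>}"
    using coset_class_refl[OF assms] by (auto simp: coset_class_def)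
  then show ?thesis by (simp add: endpoint_map_def)
qed

lemma topspace_tilde_space:
  "topspace (tilde_space X x0 K) = coset_class X x0 K ` paths_from X x0"
proof -
  have "coset_class X x0 K (\<alpha> +++ \<epsilon>) \<in> coset_class X x0 K ` paths_from X x0"
    if "\<alpha> \<in> paths_from X x0" "openin (top_of_set X) U" "\<epsilon> \<in> paths_from U (pathfinish \<alpha>)" for \<alpha> U \<epsilon>
  proof -
    have "U \<subseteq> X" using that(2) openin_imp_subset by blast
    then have "\<alpha> +++ \<epsilon> \<in> paths_from X x0"
      using that by (auto simp: paths_from_def simp: path_image_join)
    then show ?thesis by blast
  qed
  moreover have "\<exists>B. (\<exists>\<alpha> U. B = basic_nbhd X x0 K \<alpha> U \<and> \<alpha> \<in> paths_from X x0 \<and>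
      openin (top_of_set X) U \<and> pathfinish \<alpha> \<in> U) \<and> coset_class X x0 K \<alpha> \<in> B"
    if \<alpha>: "\<alpha> \<in> paths_from X x0" for \<alpha>
  proof -
    have fin: "pathfinish \<alpha> \<in> X" using \<alpha> pathfinish_in_path_image by (fastforce simp: paths_from_def)
    have "homotopic_paths X (\<alpha> +++ (\<lambda>_. pathfinish \<alpha>)) \<alpha>"
      using \<alpha> by (intro homotopic_paths_const_right) (auto simp: paths_from_def)
    from coset_class_homotopic[OF this, of x0 K]
    have "coset_class X x0 K \<alpha> \<in> basic_nbhd X x0 K \<alpha> X"
      unfolding basic_nbhd_def using paths_from_const[OF fin] by blast
    then show ?thesis using \<alpha> fin by (metis openin_subtopology_self)
  qed
  ultimately show ?thesis
    unfolding tilde_space_def topology_generated_by_topspace by (auto simp: basic_nbhd_def)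
qed

lemma homotopic_paths_cancel_middle:
  assumes "path p" "path_image p \<subseteq> X" "path q" "path_image q \<subseteq> X" "path r" "path_image r \<subseteq> X"
    and "pathfinish q = pathfinish p" "pathfinish r = pathfinish p"
    and "pathstart q = pathstart p" "pathstart r = pathstart p"
  shows "homotopic_paths X ((p +++ reversepath q) +++ (q +++ reversepath r)) (p +++ reversepath r)"
proof -
  let ?q' = "reversepath q" and ?r' = "reversepath r"
  have 1: "homotopic_paths X (p +++ (?q' +++ (q +++ ?r'))) ((p +++ ?q') +++ (q +++ ?r'))"
    using assms by (intro homotopic_paths_assoc) (auto simp: path_image_join)
  have 2: "homotopic_paths X (?q' +++ (q +++ ?r')) ((?q' +++ q) +++ ?r')"
    using assms by (intro homotopic_paths_assoc) auto
  have "homotopic_paths X (?q' +++ reversepath ?q') (\<lambda>_. pathfinish q)"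
    using assms by (intro homotopic_paths_inverse_right) auto
  then have "homotopic_paths X (?q' +++ q) (\<lambda>_. pathfinish q)" by simp
  then have 3: "homotopic_paths X ((?q' +++ q) +++ ?r') ((\<lambda>_. pathfinish q) +++ ?r')"
    using assms by (intro homotopic_paths_join) auto
  have 4: "homotopic_paths X ((\<lambda>_. pathfinish q) +++ ?r') ?r'"
    using assms by (intro homotopic_paths_const_left) auto
  have "homotopic_paths X (?q' +++ (q +++ ?r')) ?r'"
    by (rule homotopic_paths_trans[OF 2 homotopic_paths_trans[OF 3 4]])
  then have "homotopic_paths X (p +++ (?q' +++ (q +++ ?r'))) (p +++ ?r')"
    using assms by (intro homotopic_paths_join) auto
  with 1 show ?thesis by (blast intro: homotopic_paths_trans homotopic_paths_sym)
qed

lemma homotopy_class_reversepath_in_subgroup: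
  assumes "x0 \<in> X" and K: "subgroup K (fundamental_group X x0)"
    and p: "p \<in> loops_at X x0" and "homotopy_class X p \<in> K"
  shows "homotopy_class X (reversepath p) \<in> K"
proof -
  let ?G = "fundamental_group X x0"
  interpret group ?G by (rule group_fundamental_group[OF assms(1)])
  have "homotopic_paths X (reversepath p +++ reversepath (reversepath p)) (\<lambda>_. x0)"
    using p by (intro homotopic_paths_inverse_right) (auto simp: loops_at_def paths_from_def)
  then have "homotopy_class X (reversepath p +++ p) = \<one>\<^bsub>?G\<^esub>"
    by (simp add: fundamental_group_def homotopy_class_eq)
  then have "homotopy_class X (reversepath p) \<otimes>\<^bsub>?G\<^esub> homotopy_class X p = \<one>\<^bsub>?G\<^esub>"
    using p by (simp add: fundamental_group_mult loops_at_reversepath)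
  moreover have "homotopy_class X q \<in> carrier ?G" if "q \<in> loops_at X x0" for q
    using that by (simp add: fundamental_group_def)
  ultimately have "inv\<^bsub>?G\<^esub> (homotopy_class X p) = homotopy_class X (reversepath p)"
    using p by (intro inv_equality) (auto intro: loops_at_reversepath)
  then show ?thesis using subgroup.m_inv_closed[OF K assms(4)] by simp
qed

lemma coset_class_eq_iff:
  assumes "x0 \<in> X" and K: "subgroup K (fundamental_group X x0)"
    and \<alpha>: "\<alpha> \<in> paths_from X x0" and \<beta>: "\<beta> \<in> paths_from X x0"
  shows "coset_class X x0 K \<alpha> = coset_class X x0 K \<beta> \<longleftrightarrow>
    pathfinish \<alpha> = pathfinish \<beta> \<and> homotopy_class X (\<alpha> +++ reversepath \<beta>) \<in> K"
proof
  assume "coset_class X x0 K \<alpha> = coset_class X x0 K \<beta>"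
  with coset_class_refl[OF K \<beta>]
  show "pathfinish \<alpha> = pathfinish \<beta> \<and> homotopy_class X (\<alpha> +++ reversepath \<beta>) \<in> K"
    by (auto simp: coset_class_def)
next
  define R where "R p q \<longleftrightarrow> pathfinish p = pathfinish q \<and> homotopy_class X (p +++ reversepath q) \<in> K"
    for p q :: "real \<Rightarrow> 'a"
  have loop: "p +++ reversepath q \<in> loops_at X x0"
    if "p \<in> paths_from X x0" "q \<in> paths_from X x0" "pathfinish p = pathfinish q" for p q
    using that by (auto simp: loops_at_def paths_from_def simp: path_image_join)
  have sym: "R q p" if "p \<in> paths_from X x0" "q \<in> paths_from X x0" "R p q" for p q
  proof -
    have "reversepath (p +++ reversepath q) = q +++ reversepath p"
      using that by (subst reversepath_joinpaths) (auto simp: R_def)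
    then show ?thesis
      using homotopy_class_reversepath_in_subgroup[OF assms(1) K loop[OF that(1,2)]] that(3)
      by (simp add: R_def)
  qed
  have trans: "R p r"
    if "p \<in> paths_from X x0" "q \<in> paths_from X x0" "r \<in> paths_from X x0" "R p q" "R q r" for p q r
  proof -
    have "homotopy_class X (p +++ reversepath q) \<otimes>\<^bsub>fundamental_group X x0\<^esub>
        homotopy_class X (q +++ reversepath r) \<in> K"
      using that(4,5) by (intro subgroup.m_closed[OF K]) (auto simp: R_def)
    moreover have "homotopic_paths X ((p +++ reversepath q) +++ (q +++ reversepath r)) (p +++ reversepath r)"
      using that by (intro homotopic_paths_cancel_middle) (auto simp: paths_from_def R_def)
    ultimately show ?thesis
      using that loop by (simp add: R_def fundamental_group_mult homotopy_class_eq)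
  qed
  assume "pathfinish \<alpha> = pathfinish \<beta> \<and> homotopy_class X (\<alpha> +++ reversepath \<beta>) \<in> K"
  then have "R \<alpha> \<beta>" by (simp add: R_def)
  then have "R \<alpha> \<gamma> \<longleftrightarrow> R \<beta> \<gamma>" if "\<gamma> \<in> paths_from X x0" for \<gamma>
    using that \<alpha> \<beta> sym trans by blast
  then show "coset_class X x0 K \<alpha> = coset_class X x0 K \<beta>"
    by (auto simp: coset_class_def R_def)
qed

end

theory Submission
  imports Defs
begin

text \<open>
  The proof compares the two spaces of path classes through the map
  \<open>q : N[\<alpha>] \<mapsto> H[\<alpha>]\<close>, which commutes with the two endpoint projections.
  If \<open>N[\<tau> \<cdot> \<epsilon>]\<close> and \<open>N[\<tau> \<cdot> \<epsilon>']\<close>, with \<open>\<epsilon>\<close> and \<open>\<epsilon>'\<close> running in a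
  neighbourhood \<open>U\<close> of the endpoint \<open>x\<close> of \<open>\<tau>\<close>, have the same image under \<open>q\<close>,
  then \<open>[\<tau> \<cdot> \<epsilon> \<cdot> \<epsilon>'\<^sup>- \<cdot> \<tau>\<^sup>-]\<close> lies both in \<open>H\<close> and in \<open>\<pi>(x, U)\<close>.
  So the hypothesis \<open>\<pi>(x, U) \<inter> H \<subseteq> N\<close> makes \<open>q\<close> injective on the basic neighbourhoods
  \<open>B(N[\<tau>], U)\<close> (\<open>coset_class_inject_over_nbhd\<close>). As \<open>q\<close> carries basic
  neighbourhoods onto basic neighbourhoods, it is a homeomorphism there, and a short piece of a
  path in the space for \<open>H\<close> lifts through \<open>q\<close>, from any prescribed representative of its
  initial point (\<open>local_coset_lift\<close>). Since the initial representative is free, the pieces can be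
  chained, and a bisection argument lifts entire paths (\<open>coset_lift_exists\<close>).

  Now let two paths in the space for \<open>H\<close> have the same initial point \<open>H[\<sigma>]\<close> and the same
  projection to \<open>X\<close>. Their lifts through \<open>q\<close> starting at \<open>N[\<sigma>]\<close> have the same
  projection as well, hence coincide by unique path lifting for \<open>N\<close>; applying \<open>q\<close> shows that
  the original paths coincide.
\<close>


section \<open>Concatenation and coset classes\<close>

lemma paths_from_join:
  assumes "\<alpha> \<in> paths_from X x0" "\<epsilon> \<in> paths_from U (pathfinish \<alpha>)" "U \<subseteq> X"
  shows "\<alpha> +++ \<epsilon> \<in> paths_from X x0"
  using assms by (auto simp: paths_from_def path_image_join)

lemma paths_from_join_within:
  assumes "\<delta> \<in> paths_from U x" "\<epsilon> \<in> paths_from U (pathfinish \<delta>)"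
  shows "\<delta> +++ \<epsilon> \<in> paths_from U x"
  using paths_from_join[OF assms] by simp

lemma paths_from_reversepath:
  "\<epsilon> \<in> paths_from U x \<Longrightarrow> reversepath \<epsilon> \<in> paths_from U (pathfinish \<epsilon>)"
  by (auto simp: paths_from_def)

lemma pathfinish_in_paths_from: "\<epsilon> \<in> paths_from U x \<Longrightarrow> pathfinish \<epsilon> \<in> U"
  using pathfinish_in_path_image by (fastforce simp: paths_from_def)

lemma homotopic_paths_join_cancel:
  assumes "path p" "path_image p \<subseteq> X" "path q" "path_image q \<subseteq> X" "pathfinish p = pathstart q"
  shows "homotopic_paths X ((p +++ q) +++ reversepath q) p"
proof -
  have "homotopic_paths X ((p +++ q) +++ reversepath q) (p +++ (q +++ reversepath q))"
    using assms by (intro homotopic_paths_sym[OF homotopic_paths_assoc]) auto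
  also have "homotopic_paths X \<dots> (p +++ (\<lambda>_. pathstart q))"
    using assms by (intro homotopic_paths_join homotopic_paths_inverse_right) auto
  also have "homotopic_paths X \<dots> p"
    using assms by (intro homotopic_paths_const_right) auto
  finally show ?thesis .
qed

lemma coset_class_join_assoc:
  assumes "\<alpha> \<in> paths_from X x0" "\<delta> \<in> paths_from X (pathfinish \<alpha>)"
    and "\<epsilon> \<in> paths_from X (pathfinish \<delta>)"
  shows "coset_class X x0 K (\<alpha> +++ (\<delta> +++ \<epsilon>)) = coset_class X x0 K ((\<alpha> +++ \<delta>) +++ \<epsilon>)"
  using assms by (intro coset_class_homotopic homotopic_paths_assoc) (auto simp: paths_from_def)

lemma coset_class_join_cancel:
  assumes "\<alpha> \<in> paths_from X x0" "\<epsilon> \<in> paths_from X (pathfinish \<alpha>)"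
  shows "coset_class X x0 K ((\<alpha> +++ \<epsilon>) +++ reversepath \<epsilon>) = coset_class X x0 K \<alpha>"
  using assms
  by (intro coset_class_homotopic homotopic_paths_join_cancel) (auto simp: paths_from_def)

text \<open>Appending \<open>\<epsilon>\<close> to both paths does not change the loop \<open>\<alpha> \<cdot> \<beta>\<^sup>-\<close> up to homotopy.\<close>

lemma coset_class_join_cong:
  assumes "x0 \<in> X" and K: "subgroup K (fundamental_group X x0)"
    and \<alpha>: "\<alpha> \<in> paths_from X x0" and \<beta>: "\<beta> \<in> paths_from X x0"
    and \<epsilon>: "\<epsilon> \<in> paths_from X (pathfinish \<alpha>)"
    and eq: "coset_class X x0 K \<alpha> = coset_class X x0 K \<beta>"
  shows "coset_class X x0 K (\<alpha> +++ \<epsilon>) = coset_class X x0 K (\<beta> +++ \<epsilon>)"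
proof -
  have fin: "pathfinish \<alpha> = pathfinish \<beta>"
    and inK: "homotopy_class X (\<alpha> +++ reversepath \<beta>) \<in> K"
    using eq coset_class_eq_iff[OF assms(1) K \<alpha> \<beta>] by auto
  have rev: "(\<alpha> +++ \<epsilon>) +++ reversepath (\<beta> +++ \<epsilon>) = (\<alpha> +++ \<epsilon>) +++ (reversepath \<epsilon> +++ reversepath \<beta>)"
    using \<epsilon> fin by (simp add: reversepath_joinpaths paths_from_def)
  have "homotopic_paths X ((\<alpha> +++ \<epsilon>) +++ reversepath (\<beta> +++ \<epsilon>))
      (((\<alpha> +++ \<epsilon>) +++ reversepath \<epsilon>) +++ reversepath \<beta>)"
    unfolding rev using \<alpha> \<beta> \<epsilon> fin
    by (intro homotopic_paths_assoc) (auto simp: paths_from_def path_image_join)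
  also have "homotopic_paths X \<dots> (\<alpha> +++ reversepath \<beta>)"
    using \<alpha> \<beta> \<epsilon> fin
    by (intro homotopic_paths_join homotopic_paths_join_cancel) (auto simp: paths_from_def)
  finally have "homotopy_class X ((\<alpha> +++ \<epsilon>) +++ reversepath (\<beta> +++ \<epsilon>)) \<in> K"
    using inK homotopy_class_eq by metis
  then show ?thesis
    using coset_class_eq_iff[OF assms(1) K] paths_from_join[OF \<alpha> \<epsilon>] paths_from_join[OF \<beta>, of \<epsilon> X]
      \<epsilon> fin by simp
qed

lemma coset_class_eq_mono:
  assumes "x0 \<in> X" and "subgroup N (fundamental_group X x0)"
    and "subgroup H (fundamental_group X x0)" and "N \<subseteq> H"
    and "\<alpha> \<in> paths_from X x0" and "\<beta> \<in> paths_from X x0"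
    and "coset_class X x0 N \<alpha> = coset_class X x0 N \<beta>"
  shows "coset_class X x0 H \<alpha> = coset_class X x0 H \<beta>"
  using assms(4,7) coset_class_eq_iff[OF assms(1,2,5,6)] coset_class_eq_iff[OF assms(1,3,5,6)]
  by blast

text \<open>
  The loop that witnesses the equality of the two \<open>H\<close>-classes is homotopic to
  \<open>\<tau> \<cdot> (\<epsilon> \<cdot> \<epsilon>'\<^sup>-) \<cdot> \<tau>\<^sup>-\<close>, a generator of \<open>\<pi>(x, U)\<close>.
\<close>

lemma coset_class_inject_over_nbhd:
  assumes "x0 \<in> X" and N: "subgroup N (fundamental_group X x0)"
    and H: "subgroup H (fundamental_group X x0)"
    and "U \<subseteq> X" and small: "pi_nbhd X x0 (pathfinish \<tau>) U \<inter> H \<subseteq> N"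
    and \<tau>: "\<tau> \<in> paths_from X x0"
    and \<epsilon>: "\<epsilon> \<in> paths_from U (pathfinish \<tau>)" and \<epsilon>': "\<epsilon>' \<in> paths_from U (pathfinish \<tau>)"
    and eq: "coset_class X x0 H (\<tau> +++ \<epsilon>) = coset_class X x0 H (\<tau> +++ \<epsilon>')"
  shows "coset_class X x0 N (\<tau> +++ \<epsilon>) = coset_class X x0 N (\<tau> +++ \<epsilon>')"
proof -
  let ?l = "(\<tau> +++ \<epsilon>) +++ reversepath (\<tau> +++ \<epsilon>')"
  note joins = paths_from_join[OF \<tau> \<epsilon> \<open>U \<subseteq> X\<close>] paths_from_join[OF \<tau> \<epsilon>' \<open>U \<subseteq> X\<close>]
  have fin: "pathfinish \<epsilon> = pathfinish \<epsilon>'" and inH: "homotopy_class X ?l \<in> H"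
    using eq coset_class_eq_iff[OF assms(1) H joins] by auto
  have rev: "?l = (\<tau> +++ \<epsilon>) +++ (reversepath \<epsilon>' +++ reversepath \<tau>)"
    using \<epsilon>' by (simp add: reversepath_joinpaths paths_from_def)
  have "homotopic_paths X ?l (\<tau> +++ (\<epsilon> +++ (reversepath \<epsilon>' +++ reversepath \<tau>)))"
    unfolding rev using \<tau> \<epsilon> \<epsilon>' fin \<open>U \<subseteq> X\<close>
    by (intro homotopic_paths_sym[OF homotopic_paths_assoc])
      (auto simp: paths_from_def path_image_join)
  also have "homotopic_paths X \<dots> (\<tau> +++ ((\<epsilon> +++ reversepath \<epsilon>') +++ reversepath \<tau>))"
    using \<tau> \<epsilon> \<epsilon>' fin \<open>U \<subseteq> X\<close>
    by (intro homotopic_paths_join homotopic_paths_assoc) (auto simp: paths_from_def)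
  finally have "homotopy_class X ?l
      = homotopy_class X (\<tau> +++ (\<epsilon> +++ reversepath \<epsilon>') +++ reversepath \<tau>)"
    by (rule homotopy_class_eq)
  moreover have "\<epsilon> +++ reversepath \<epsilon>' \<in> loops_at U (pathfinish \<tau>)"
    using \<epsilon> \<epsilon>' fin by (auto simp: loops_at_def paths_from_def path_image_join)
  ultimately have "homotopy_class X ?l \<in> pi_nbhd X x0 (pathfinish \<tau>) U"
    unfolding pi_nbhd_def using \<tau> by (auto intro!: generate.incl)
  with inH small have "homotopy_class X ?l \<in> N" by blast
  with fin show ?thesis
    using coset_class_eq_iff[OF assms(1) N joins] by simp
qed


section \<open>Basic neighbourhoods\<close>

lemma openin_basic_nbhd:
  assumes "\<alpha> \<in> paths_from X x0" "openin (top_of_set X) U" "pathfinish \<alpha> \<in> U"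
  shows "openin (tilde_space X x0 K) (basic_nbhd X x0 K \<alpha> U)"
  unfolding tilde_space_def using assms by (intro topology_generated_by_Basis) blast

lemma coset_class_in_basic_nbhd:
  assumes "\<alpha> \<in> paths_from X x0" "U \<subseteq> X" "pathfinish \<alpha> \<in> U"
  shows "coset_class X x0 K \<alpha> \<in> basic_nbhd X x0 K \<alpha> U"
proof -
  have "coset_class X x0 K (\<alpha> +++ (\<lambda>_. pathfinish \<alpha>)) = coset_class X x0 K \<alpha>"
    using assms
    by (intro coset_class_homotopic homotopic_paths_const_right) (auto simp: paths_from_def)
  then show ?thesis
    unfolding basic_nbhd_def using paths_from_const[OF assms(3)] by blast
qed

lemma basic_nbhd_subset_join:
  assumes \<alpha>: "\<alpha> \<in> paths_from X x0" and "U \<subseteq> X" and \<epsilon>: "\<epsilon> \<in> paths_from U (pathfinish \<alpha>)"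
  shows "basic_nbhd X x0 K (\<alpha> +++ \<epsilon>) U \<subseteq> basic_nbhd X x0 K \<alpha> U"
proof -
  have "coset_class X x0 K ((\<alpha> +++ \<epsilon>) +++ \<delta>) \<in> basic_nbhd X x0 K \<alpha> U"
    if "\<delta> \<in> paths_from U (pathfinish \<epsilon>)" for \<delta>
  proof -
    have "coset_class X x0 K ((\<alpha> +++ \<epsilon>) +++ \<delta>) = coset_class X x0 K (\<alpha> +++ (\<epsilon> +++ \<delta>))"
      using that assms
      by (intro coset_class_join_assoc[symmetric]) (auto simp: paths_from_def)
    moreover have "\<epsilon> +++ \<delta> \<in> paths_from U (pathfinish \<alpha>)"
      using \<epsilon> that by (rule paths_from_join_within)
    ultimately show ?thesis unfolding basic_nbhd_def by blast
  qed
  then show ?thesis unfolding basic_nbhd_def[of X x0 K "\<alpha> +++ \<epsilon>"] by auto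
qed

lemma basic_nbhd_cong:
  assumes "x0 \<in> X" and K: "subgroup K (fundamental_group X x0)"
    and \<alpha>: "\<alpha> \<in> paths_from X x0" and \<beta>: "\<beta> \<in> paths_from X x0" and "U \<subseteq> X"
    and eq: "coset_class X x0 K \<alpha> = coset_class X x0 K \<beta>"
  shows "basic_nbhd X x0 K \<alpha> U = basic_nbhd X x0 K \<beta> U"
proof -
  have fin: "pathfinish \<alpha> = pathfinish \<beta>"
    using eq coset_class_eq_iff[OF assms(1) K \<alpha> \<beta>] by simp
  have "coset_class X x0 K (\<alpha> +++ \<epsilon>) = coset_class X x0 K (\<beta> +++ \<epsilon>)"
    if "\<epsilon> \<in> paths_from U (pathfinish \<beta>)" for \<epsilon>
    using that fin \<open>U \<subseteq> X\<close>
    by (intro coset_class_join_cong[OF assms(1) K \<alpha> \<beta> _ eq]) (auto simp: paths_from_def)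
  then show ?thesis unfolding basic_nbhd_def fin by blast
qed

text \<open>
  Travelling back along the path that leads from the old centre to the new one exchanges
  the roles of the two centres, so one inclusion yields the other.
\<close>

lemma basic_nbhd_recenter:
  assumes "x0 \<in> X" and K: "subgroup K (fundamental_group X x0)"
    and \<alpha>: "\<alpha> \<in> paths_from X x0" and \<beta>: "\<beta> \<in> paths_from X x0" and "U \<subseteq> X"
    and "coset_class X x0 K \<beta> \<in> basic_nbhd X x0 K \<alpha> U"
  shows "basic_nbhd X x0 K \<beta> U = basic_nbhd X x0 K \<alpha> U"
proof -
  obtain \<epsilon> where \<epsilon>: "\<epsilon> \<in> paths_from U (pathfinish \<alpha>)"
    and eq: "coset_class X x0 K \<beta> = coset_class X x0 K (\<alpha> +++ \<epsilon>)"
    using assms(6) unfolding basic_nbhd_def by blast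
  have \<alpha>\<epsilon>: "\<alpha> +++ \<epsilon> \<in> paths_from X x0" using \<alpha> \<epsilon> \<open>U \<subseteq> X\<close> by (rule paths_from_join)
  have r\<epsilon>: "reversepath \<epsilon> \<in> paths_from U (pathfinish (\<alpha> +++ \<epsilon>))"
    using paths_from_reversepath[OF \<epsilon>] by simp
  have "coset_class X x0 K ((\<alpha> +++ \<epsilon>) +++ reversepath \<epsilon>) = coset_class X x0 K \<alpha>"
    using \<epsilon> \<open>U \<subseteq> X\<close> by (intro coset_class_join_cancel[OF \<alpha>]) (auto simp: paths_from_def)
  then have "basic_nbhd X x0 K \<alpha> U = basic_nbhd X x0 K ((\<alpha> +++ \<epsilon>) +++ reversepath \<epsilon>) U"
    using paths_from_join[OF \<alpha>\<epsilon> r\<epsilon> \<open>U \<subseteq> X\<close>] \<alpha> \<open>U \<subseteq> X\<close>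
    by (intro basic_nbhd_cong[OF assms(1) K]) auto
  also have "\<dots> \<subseteq> basic_nbhd X x0 K (\<alpha> +++ \<epsilon>) U"
    using \<alpha>\<epsilon> \<open>U \<subseteq> X\<close> r\<epsilon> by (rule basic_nbhd_subset_join)
  finally have "basic_nbhd X x0 K (\<alpha> +++ \<epsilon>) U = basic_nbhd X x0 K \<alpha> U"
    using basic_nbhd_subset_join[OF \<alpha> \<open>U \<subseteq> X\<close> \<epsilon>, of K] by blast
  then show ?thesis using basic_nbhd_cong[OF assms(1) K \<beta> \<alpha>\<epsilon> \<open>U \<subseteq> X\<close> eq] by simp
qed

text \<open>The preimage of an open set \<open>U\<close> is the union of the basic neighbourhoods over \<open>U\<close>.\<close>

lemma continuous_map_endpoint_map:
  assumes K: "subgroup K (fundamental_group X x0)"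
  shows "continuous_map (tilde_space X x0 K) (top_of_set X) endpoint_map"
  unfolding continuous_map_def
proof (intro conjI allI impI)
  show "endpoint_map \<in> topspace (tilde_space X x0 K) \<rightarrow> topspace (top_of_set X)"
    using pathfinish_in_paths_from
    by (fastforce simp: topspace_tilde_space endpoint_map_coset_class[OF K])
  fix U assume U: "openin (top_of_set X) U"
  then have UX: "U \<subseteq> X" by (rule openin_imp_subset)
  show "openin (tilde_space X x0 K) {c \<in> topspace (tilde_space X x0 K). endpoint_map c \<in> U}"
  proof (subst openin_subopen, safe)
    fix c assume "c \<in> topspace (tilde_space X x0 K)" and cU: "endpoint_map c \<in> U"
    then obtain \<alpha> where \<alpha>: "\<alpha> \<in> paths_from X x0" and c: "c = coset_class X x0 K \<alpha>"
      by (auto simp: topspace_tilde_space)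
    have fin: "pathfinish \<alpha> \<in> U" using cU by (simp add: c endpoint_map_coset_class[OF K \<alpha>])
    have "d \<in> topspace (tilde_space X x0 K) \<and> endpoint_map d \<in> U"
      if "d \<in> basic_nbhd X x0 K \<alpha> U" for d
    proof -
      obtain \<epsilon> where \<epsilon>: "\<epsilon> \<in> paths_from U (pathfinish \<alpha>)" and d: "d = coset_class X x0 K (\<alpha> +++ \<epsilon>)"
        using \<open>d \<in> basic_nbhd X x0 K \<alpha> U\<close> by (auto simp: basic_nbhd_def)
      have "\<alpha> +++ \<epsilon> \<in> paths_from X x0" using \<alpha> \<epsilon> UX by (rule paths_from_join)
      then show ?thesis
        using pathfinish_in_paths_from[OF \<epsilon>]
        by (auto simp: d topspace_tilde_space endpoint_map_coset_class[OF K])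
    qed
    then show "\<exists>T. openin (tilde_space X x0 K) T \<and> c \<in> T \<and>
        T \<subseteq> {c \<in> topspace (tilde_space X x0 K). endpoint_map c \<in> U}"
      using openin_basic_nbhd[OF \<alpha> U fin] coset_class_in_basic_nbhd[OF \<alpha> UX fin] c
      by (intro exI[of _ "basic_nbhd X x0 K \<alpha> U"]) auto
  qed
qed


section \<open>Lifting paths from the quotient by the larger subgroup\<close>

text \<open>
  On points of the two spaces, \<open>coset_over X x0 N H c d\<close> says that \<open>d\<close> is the image of \<open>c\<close>
  under \<open>N[\<alpha>] \<mapsto> H[\<alpha>]\<close>; a relation needs no choice of representatives.
\<close>

definition coset_over ::
    "'a::topological_space set \<Rightarrow> 'a \<Rightarrow> (real \<Rightarrow> 'a) set set \<Rightarrow> (real \<Rightarrow> 'a) set set \<Rightarrow>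
     (real \<Rightarrow> 'a) set \<Rightarrow> (real \<Rightarrow> 'a) set \<Rightarrow> bool" where
  "coset_over X x0 N H c d \<longleftrightarrow>
    (\<exists>\<alpha>\<in>paths_from X x0. c = coset_class X x0 N \<alpha> \<and> d = coset_class X x0 H \<alpha>)"

definition coset_lift ::
    "'a::topological_space set \<Rightarrow> 'a \<Rightarrow> (real \<Rightarrow> 'a) set set \<Rightarrow> (real \<Rightarrow> 'a) set set \<Rightarrow>
     real set \<Rightarrow> (real \<Rightarrow> (real \<Rightarrow> 'a) set) \<Rightarrow> (real \<Rightarrow> (real \<Rightarrow> 'a) set) \<Rightarrow> bool" where
  "coset_lift X x0 N H S g h \<longleftrightarrow>
    continuous_map (top_of_set S) (tilde_space X x0 N) h \<and> (\<forall>s\<in>S. coset_over X x0 N H (h s) (g s))"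

text \<open>
  The inverse of \<open>N[\<tau> \<cdot> \<epsilon>] \<mapsto> H[\<tau> \<cdot> \<epsilon>]\<close> on the basic neighbourhood at \<open>\<tau>\<close> is composed with \<open>g\<close>.
  Continuity at \<open>s\<close> is tested on \<open>B(N[\<beta>], V)\<close>, which may be recentred at \<open>h s = N[\<rho>]\<close>:
  points of \<open>B(H[\<rho>], U \<inter> V)\<close> have the form \<open>H[\<rho> \<cdot> \<delta>]\<close> with \<open>\<delta>\<close> in \<open>U \<inter> V\<close>, and as \<open>\<rho> \<cdot> \<delta>\<close> is
  again of the form \<open>\<tau> \<cdot> \<epsilon>\<close>, injectivity forces the inverse to send them to \<open>N[\<rho> \<cdot> \<delta>]\<close>.
\<close>

lemma coset_lift_in_basic_nbhd:
  assumes x0: "x0 \<in> X" and N: "subgroup N (fundamental_group X x0)"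
    and H: "subgroup H (fundamental_group X x0)"
    and U: "openin (top_of_set X) U" and small: "pi_nbhd X x0 (pathfinish \<tau>) U \<inter> H \<subseteq> N"
    and \<tau>: "\<tau> \<in> paths_from X x0" and \<eta>: "\<eta> \<in> paths_from U (pathfinish \<tau>)"
    and g: "continuous_map (top_of_set S) (tilde_space X x0 H) g"
    and gU: "g ` S \<subseteq> basic_nbhd X x0 H \<tau> U"
    and a: "g a = coset_class X x0 H (\<tau> +++ \<eta>)"
  shows "\<exists>h. coset_lift X x0 N H S g h \<and> (a \<in> S \<longrightarrow> h a = coset_class X x0 N (\<tau> +++ \<eta>))"
proof -
  have UX: "U \<subseteq> X" using U by (rule openin_imp_subset)
  have "\<forall>s\<in>S. \<exists>\<epsilon>. \<epsilon> \<in> paths_from U (pathfinish \<tau>) \<and> g s = coset_class X x0 H (\<tau> +++ \<epsilon>)"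
    using gU by (auto simp: basic_nbhd_def)
  then obtain e where e: "\<And>s. s \<in> S \<Longrightarrow> e s \<in> paths_from U (pathfinish \<tau>)"
    and ge: "\<And>s. s \<in> S \<Longrightarrow> g s = coset_class X x0 H (\<tau> +++ e s)"
    by metis
  define h where "h s = coset_class X x0 N (\<tau> +++ e s)" for s
  have \<tau>e: "\<tau> +++ e s \<in> paths_from X x0" if "s \<in> S" for s
    using \<tau> e[OF that] UX by (rule paths_from_join)
  have h_eq: "h s = coset_class X x0 N (\<tau> +++ \<epsilon>)"
    if "s \<in> S" "\<epsilon> \<in> paths_from U (pathfinish \<tau>)" "g s = coset_class X x0 H (\<tau> +++ \<epsilon>)" for s \<epsilon>
    unfolding h_def using that ge[OF that(1)] e[OF that(1)]
    by (intro coset_class_inject_over_nbhd[OF x0 N H UX small \<tau>]) auto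
  have "continuous_map (top_of_set S) (tilde_space X x0 N) h"
    unfolding tilde_space_def
  proof (rule continuous_on_generated_topo)
    fix W
    assume "W \<in> {basic_nbhd X x0 N \<alpha> U |\<alpha> U.
        \<alpha> \<in> paths_from X x0 \<and> openin (top_of_set X) U \<and> pathfinish \<alpha> \<in> U}"
    then obtain \<beta> V where W: "W = basic_nbhd X x0 N \<beta> V" and \<beta>: "\<beta> \<in> paths_from X x0"
      and V: "openin (top_of_set X) V" by blast
    have VX: "V \<subseteq> X" using V by (rule openin_imp_subset)
    show "openin (top_of_set S) (h -` W \<inter> topspace (top_of_set S))"
    proof (subst openin_subopen, safe)
      fix s assume hs: "h s \<in> W" and "s \<in> topspace (top_of_set S)"
      then have s: "s \<in> S" by simp
      let ?\<rho> = "\<tau> +++ e s" and ?T = "{r \<in> S. g r \<in> basic_nbhd X x0 H (\<tau> +++ e s) (U \<inter> V)}"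
      have W\<rho>: "W = basic_nbhd X x0 N ?\<rho> V"
        using basic_nbhd_recenter[OF x0 N \<beta> \<tau>e[OF s] VX] hs by (simp add: W h_def)
      obtain \<epsilon> where "\<epsilon> \<in> paths_from V (pathfinish \<beta>)" "h s = coset_class X x0 N (\<beta> +++ \<epsilon>)"
        using hs by (auto simp: W basic_nbhd_def)
      then have "pathfinish ?\<rho> \<in> V"
        using coset_class_eq_iff[OF x0 N \<tau>e[OF s] paths_from_join[OF \<beta> _ VX]]
          pathfinish_in_paths_from by (metis h_def pathfinish_join)
      then have fin: "pathfinish ?\<rho> \<in> U \<inter> V" using pathfinish_in_paths_from[OF e[OF s]] by simp
      have UV: "openin (top_of_set X) (U \<inter> V)" using U V by (rule openin_Int)
      have "openin (top_of_set S) ?T"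
        using openin_continuous_map_preimage[OF g openin_basic_nbhd[OF \<tau>e[OF s] UV fin]] by simp
      moreover have "s \<in> ?T"
        using s coset_class_in_basic_nbhd[OF \<tau>e[OF s] _ fin] UX by (auto simp: ge[OF s])
      moreover have "h r \<in> W" if "r \<in> ?T" for r
      proof -
        obtain \<delta> where \<delta>: "\<delta> \<in> paths_from (U \<inter> V) (pathfinish (e s))"
          and gr: "g r = coset_class X x0 H (?\<rho> +++ \<delta>)" and r: "r \<in> S"
          using \<open>r \<in> ?T\<close> by (auto simp: basic_nbhd_def)
        have \<delta>U: "\<delta> \<in> paths_from U (pathfinish (e s))" and \<delta>V: "\<delta> \<in> paths_from V (pathfinish ?\<rho>)"
          using \<delta> by (auto simp: paths_from_def)
        have assoc: "coset_class X x0 K (\<tau> +++ (e s +++ \<delta>)) = coset_class X x0 K (?\<rho> +++ \<delta>)" for K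
          using e[OF s] \<delta>U UX by (intro coset_class_join_assoc[OF \<tau>]) (auto simp: paths_from_def)
        have "h r = coset_class X x0 N (\<tau> +++ (e s +++ \<delta>))"
          using r paths_from_join_within[OF e[OF s] \<delta>U] by (rule h_eq) (simp add: gr assoc)
        then show ?thesis using \<delta>V unfolding W\<rho> basic_nbhd_def assoc by blast
      qed
      ultimately show "\<exists>T. openin (top_of_set S) T \<and> s \<in> T \<and>
          T \<subseteq> h -` W \<inter> topspace (top_of_set S)"
        by (intro exI[of _ ?T]) auto
    qed
  next
    have "h ` S \<subseteq> topspace (tilde_space X x0 N)"
      using \<tau>e by (auto simp: topspace_tilde_space h_def)
    then show "h ` topspace (top_of_set S) \<subseteq> \<Union> {basic_nbhd X x0 N \<alpha> U |\<alpha> U.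
        \<alpha> \<in> paths_from X x0 \<and> openin (top_of_set X) U \<and> pathfinish \<alpha> \<in> U}"
      unfolding tilde_space_def topology_generated_by_topspace by simp
  qed
  then have "coset_lift X x0 N H S g h"
    unfolding coset_lift_def coset_over_def using \<tau>e ge h_def by blast
  moreover have "h a = coset_class X x0 N (\<tau> +++ \<eta>)" if "a \<in> S"
    using that \<eta> a by (rule h_eq)
  ultimately show ?thesis by blast
qed

text \<open>
  The initial representative \<open>\<sigma>\<close> over \<open>a\<close> is prescribed, whereas the neighbourhood \<open>U\<close> belongs to
  the point under \<open>g x\<close>. Carrying \<open>\<sigma>\<close> back to that point inside \<open>U\<close> gives a centre \<open>\<tau>\<close>
  for which the lift starts at the prescribed class.
\<close>

lemma local_coset_lift:
  assumes x0: "x0 \<in> X" and N: "subgroup N (fundamental_group X x0)"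
    and H: "subgroup H (fundamental_group X x0)"
    and small: "\<forall>x\<in>X. \<exists>U. openin (top_of_set X) U \<and> x \<in> U \<and> pi_nbhd X x0 x U \<inter> H \<subseteq> N"
    and g: "continuous_map (top_of_set S) (tilde_space X x0 H) g" and x: "x \<in> S"
  shows "\<exists>T. openin (top_of_set S) T \<and> x \<in> T \<and>
    (\<forall>a\<in>T. \<forall>\<sigma>\<in>paths_from X x0. g a = coset_class X x0 H \<sigma> \<longrightarrow>
      (\<exists>h. coset_lift X x0 N H T g h \<and> h a = coset_class X x0 N \<sigma>))"
proof -
  obtain \<mu> where \<mu>: "\<mu> \<in> paths_from X x0" and gx: "g x = coset_class X x0 H \<mu>"
    using continuous_map_image_subset_topspace[OF g] x by (auto simp: topspace_tilde_space)
  then obtain U where U: "openin (top_of_set X) U" and fin: "pathfinish \<mu> \<in> U"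
    and pi: "pi_nbhd X x0 (pathfinish \<mu>) U \<inter> H \<subseteq> N"
    using small pathfinish_in_paths_from by meson
  have UX: "U \<subseteq> X" using U by (rule openin_imp_subset)
  let ?T = "{s \<in> S. g s \<in> basic_nbhd X x0 H \<mu> U}"
  have "openin (top_of_set S) ?T"
    using openin_continuous_map_preimage[OF g openin_basic_nbhd[OF \<mu> U fin]] by simp
  moreover have "x \<in> ?T" using x coset_class_in_basic_nbhd[OF \<mu> UX fin] by (simp add: gx)
  moreover have "\<exists>h. coset_lift X x0 N H ?T g h \<and> h a = coset_class X x0 N \<sigma>"
    if "a \<in> ?T" and \<sigma>: "\<sigma> \<in> paths_from X x0" and ga: "g a = coset_class X x0 H \<sigma>" for a \<sigma>
  proof -
    obtain \<eta> where \<eta>: "\<eta> \<in> paths_from U (pathfinish \<mu>)"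
      and ga': "g a = coset_class X x0 H (\<mu> +++ \<eta>)"
      using \<open>a \<in> ?T\<close> by (auto simp: basic_nbhd_def)
    let ?\<tau> = "\<sigma> +++ reversepath \<eta>"
    have \<mu>\<eta>: "\<mu> +++ \<eta> \<in> paths_from X x0" using \<mu> \<eta> UX by (rule paths_from_join)
    have eq: "coset_class X x0 H \<sigma> = coset_class X x0 H (\<mu> +++ \<eta>)" using ga ga' by simp
    then have fin\<sigma>: "pathfinish \<sigma> = pathfinish \<eta>"
      using coset_class_eq_iff[OF x0 H \<sigma> \<mu>\<eta>] by simp
    have fin\<tau>: "pathfinish ?\<tau> = pathfinish \<mu>" using \<eta> by (simp add: paths_from_def)
    have r\<eta>: "reversepath \<eta> \<in> paths_from U (pathfinish \<sigma>)"
      using paths_from_reversepath[OF \<eta>] by (simp add: fin\<sigma>)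
    have \<tau>: "?\<tau> \<in> paths_from X x0" using \<sigma> r\<eta> UX by (rule paths_from_join)
    have r\<eta>X: "reversepath \<eta> \<in> paths_from X (pathfinish \<sigma>)" and \<eta>X: "\<eta> \<in> paths_from X (pathfinish \<mu>)"
      using r\<eta> \<eta> UX by (auto simp: paths_from_def)
    have "coset_class X x0 H ?\<tau> = coset_class X x0 H ((\<mu> +++ \<eta>) +++ reversepath \<eta>)"
      by (rule coset_class_join_cong[OF x0 H \<sigma> \<mu>\<eta> r\<eta>X eq])
    also have "\<dots> = coset_class X x0 H \<mu>" by (rule coset_class_join_cancel[OF \<mu> \<eta>X])
    finally have nbhd: "basic_nbhd X x0 H ?\<tau> U = basic_nbhd X x0 H \<mu> U"
      by (rule basic_nbhd_cong[OF x0 H \<tau> \<mu> UX])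
    have cancel: "coset_class X x0 K (?\<tau> +++ \<eta>) = coset_class X x0 K \<sigma>" for K
      using coset_class_join_cancel[OF \<sigma> r\<eta>X] by simp
    have gT: "continuous_map (top_of_set ?T) (tilde_space X x0 H) g"
      by (rule continuous_map_from_subtopology_mono[OF g]) auto
    have pi\<tau>: "pi_nbhd X x0 (pathfinish ?\<tau>) U \<inter> H \<subseteq> N" and \<eta>\<tau>: "\<eta> \<in> paths_from U (pathfinish ?\<tau>)"
      using pi \<eta> by (simp_all only: fin\<tau>)
    have gaH: "g a = coset_class X x0 H (?\<tau> +++ \<eta>)" using ga by (simp only: cancel)
    have gU: "g ` ?T \<subseteq> basic_nbhd X x0 H ?\<tau> U" using nbhd by auto
    show ?thesis
      using coset_lift_in_basic_nbhd[OF x0 N H U pi\<tau> \<tau> \<eta>\<tau> gT gU gaH] \<open>a \<in> ?T\<close>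
      unfolding cancel by blast
  qed
  ultimately show ?thesis by (intro exI[of _ ?T] conjI ballI impI)
qed

lemma coset_lift_subset:
  assumes "coset_lift X x0 N H S g h" "T \<subseteq> S"
  shows "coset_lift X x0 N H T g h"
  using assms continuous_map_from_subtopology_mono[OF _ assms(2)]
  unfolding coset_lift_def by blast

lemma coset_lift_glue:
  assumes h: "coset_lift X x0 N H {a..b} g h" and k: "coset_lift X x0 N H {b..c} g k"
    and "h b = k b" and "a \<le> b" and "b \<le> c"
  shows "coset_lift X x0 N H {a..c} g (\<lambda>s. if s \<le> b then h s else k s)"
proof -
  have "{s \<in> {a..c}. s \<le> b} = {a..b}" "{s \<in> {a..c}. b \<le> s} = {b..c}" using assms(4,5) by auto
  moreover have "{a..c} \<inter> {a..b} = {a..b}" "{a..c} \<inter> {b..c} = {b..c}" using assms(4,5) by auto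
  ultimately have "continuous_map (top_of_set {a..c}) (tilde_space X x0 N)
      (\<lambda>s. if s \<le> b then h s else k s)"
    using h k \<open>h b = k b\<close>
    by (intro continuous_map_cases_le)
      (auto simp: coset_lift_def subtopology_subtopology)
  then show ?thesis using h k by (auto simp: coset_lift_def)
qed

text \<open>
  The property "every representative of \<open>g u\<close> starts a lift over \<open>{u..v}\<close>" passes to
  adjacent intervals, because the second lift may start from the endpoint of the first.
\<close>

lemma coset_lift_exists:
  assumes x0: "x0 \<in> X" and N: "subgroup N (fundamental_group X x0)"
    and H: "subgroup H (fundamental_group X x0)"
    and small: "\<forall>x\<in>X. \<exists>U. openin (top_of_set X) U \<and> x \<in> U \<and> pi_nbhd X x0 x U \<inter> H \<subseteq> N"
    and g: "pathin (tilde_space X x0 H) g"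
    and \<sigma>: "\<sigma> \<in> paths_from X x0" "g 0 = coset_class X x0 H \<sigma>"
  shows "\<exists>h. coset_lift X x0 N H {0..1} g h \<and> h 0 = coset_class X x0 N \<sigma>"
proof -
  have gc: "continuous_map (top_of_set {0..1}) (tilde_space X x0 H) g"
    using g by (simp add: pathin_def)
  define P where "P u v \<longleftrightarrow> (0 \<le> u \<and> u \<le> v \<and> v \<le> 1 \<longrightarrow>
      (\<forall>\<sigma>\<in>paths_from X x0. g u = coset_class X x0 H \<sigma> \<longrightarrow>
        (\<exists>h. coset_lift X x0 N H {u..v} g h \<and> h u = coset_class X x0 N \<sigma>)))" for u v :: real
  have "P 0 1"
  proof (rule Bolzano)
    show "(0::real) \<le> 1" by simp
  next
    fix a b c :: real
    assume ab: "P a b" and bc: "P b c" and "a \<le> b" "b \<le> c"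
    show "P a c"
      unfolding P_def
    proof (intro impI ballI)
      fix \<sigma> assume ac: "0 \<le> a \<and> a \<le> c \<and> c \<le> 1" and \<sigma>: "\<sigma> \<in> paths_from X x0"
        and ga: "g a = coset_class X x0 H \<sigma>"
      obtain h where h: "coset_lift X x0 N H {a..b} g h" "h a = coset_class X x0 N \<sigma>"
        using ab ac \<open>a \<le> b\<close> \<open>b \<le> c\<close> \<sigma> ga by (auto simp: P_def)
      then obtain \<rho> where \<rho>: "\<rho> \<in> paths_from X x0" "h b = coset_class X x0 N \<rho>"
        "g b = coset_class X x0 H \<rho>"
        using \<open>a \<le> b\<close> unfolding coset_lift_def coset_over_def by (metis atLeastAtMost_iff order_refl)
      then obtain k where k: "coset_lift X x0 N H {b..c} g k" "k b = coset_class X x0 N \<rho>"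
        using bc ac \<open>a \<le> b\<close> \<open>b \<le> c\<close> by (auto simp: P_def)
      show "\<exists>h. coset_lift X x0 N H {a..c} g h \<and> h a = coset_class X x0 N \<sigma>"
        using coset_lift_glue[OF h(1) k(1) _ \<open>a \<le> b\<close> \<open>b \<le> c\<close>] h(2) k(2) \<rho>(2) \<open>a \<le> b\<close>
        by (intro exI[of _ "\<lambda>s. if s \<le> b then h s else k s"]) simp
    qed
  next
    fix x :: real assume "0 \<le> x" "x \<le> 1"
    then have "x \<in> {0..1}" by simp
    from local_coset_lift[OF x0 N H small gc this]
    obtain T where T: "openin (top_of_set {0..1}) T" "x \<in> T"
      and lift: "\<forall>a\<in>T. \<forall>\<sigma>\<in>paths_from X x0. g a = coset_class X x0 H \<sigma> \<longrightarrow>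
        (\<exists>h. coset_lift X x0 N H T g h \<and> h a = coset_class X x0 N \<sigma>)"
      by (elim exE conjE)
    obtain d where d: "d > 0" "ball x d \<inter> {0..1} \<subseteq> T"
      using T unfolding openin_contains_ball by blast
    have "P a b" if "a \<le> x" "x \<le> b" "b - a < d" for a b
      unfolding P_def
    proof (intro impI ballI)
      fix \<sigma> assume ab: "0 \<le> a \<and> a \<le> b \<and> b \<le> 1" and \<sigma>: "\<sigma> \<in> paths_from X x0"
        and ga: "g a = coset_class X x0 H \<sigma>"
      have "{a..b} \<subseteq> ball x d \<inter> {0..1}" using that ab by (auto simp: dist_real_def)
      then have "{a..b} \<subseteq> T" using d(2) by blast
      moreover from this have "a \<in> T" using ab by auto
      ultimately show "\<exists>h. coset_lift X x0 N H {a..b} g h \<and> h a = coset_class X x0 N \<sigma>"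
        using lift \<sigma> ga coset_lift_subset by metis
    qed
    then show "\<exists>d>0. \<forall>a b. a \<le> x \<and> x \<le> b \<and> b - a < d \<longrightarrow> P a b" using d(1) by blast
  qed
  then show ?thesis using \<sigma> by (auto simp: P_def)
qed


section \<open>Unique path lifting for the larger subgroup\<close>

theorem theorem5p4:
  fixes X :: "'a::metric_space set" and x0 :: 'a
    and N H :: "(real \<Rightarrow> 'a) set set"
  assumes "path_connected X" and "x0 \<in> X"
    and "N \<lhd> fundamental_group X x0"
    and "subgroup H (fundamental_group X x0)"
    and "N \<subseteq> H"
    and "unique_path_lifting (tilde_space X x0 N) (top_of_set X) endpoint_map"
    and "\<forall>x\<in>X. \<exists>U. openin (top_of_set X) U \<and> x \<in> U \<and> pi_nbhd X x0 x U \<inter> H \<subseteq> N"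
  shows "unique_path_lifting (tilde_space X x0 H) (top_of_set X) endpoint_map"
proof -
  note x0 = assms(2) and H = assms(4) and small = assms(7)
  have N: "subgroup N (fundamental_group X x0)" using assms(3) by (rule normal_imp_subgroup)
  have endpoint: "endpoint_map c = endpoint_map d" if "coset_over X x0 N H c d" for c d
    using that by (auto simp: coset_over_def endpoint_map_coset_class[OF N] endpoint_map_coset_class[OF H])
  have single: "d = d'" if "coset_over X x0 N H c d" "coset_over X x0 N H c d'" for c d d'
    using that coset_class_eq_mono[OF x0 N H \<open>N \<subseteq> H\<close>] unfolding coset_over_def by metis
  show ?thesis
    unfolding unique_path_lifting_def
  proof (intro conjI allI impI)
    show "continuous_map (tilde_space X x0 H) (top_of_set X) endpoint_map"
      by (rule continuous_map_endpoint_map[OF H])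
    fix f g assume f: "pathin (tilde_space X x0 H) f" and g: "pathin (tilde_space X x0 H) g"
      and "f 0 = g 0" and proj: "\<forall>t\<in>{0..1}. endpoint_map (f t) = endpoint_map (g t)"
    obtain \<sigma> where \<sigma>: "\<sigma> \<in> paths_from X x0" "f 0 = coset_class X x0 H \<sigma>"
      using f continuous_map_image_subset_topspace[of "top_of_set {0..1}" _ f]
      by (force simp: pathin_def topspace_tilde_space)
    obtain f' where f': "coset_lift X x0 N H {0..1} f f'" "f' 0 = coset_class X x0 N \<sigma>"
      using coset_lift_exists[OF x0 N H small f \<sigma>] by blast
    obtain g' where g': "coset_lift X x0 N H {0..1} g g'" "g' 0 = coset_class X x0 N \<sigma>"
      using coset_lift_exists[OF x0 N H small g] \<sigma> \<open>f 0 = g 0\<close> by metis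
    have "pathin (tilde_space X x0 N) f'" "pathin (tilde_space X x0 N) g'"
      using f'(1) g'(1) by (auto simp: coset_lift_def pathin_def)
    moreover have "\<forall>t\<in>{0..1}. endpoint_map (f' t) = endpoint_map (g' t)"
      using f'(1) g'(1) proj endpoint unfolding coset_lift_def by metis
    ultimately have "\<forall>t\<in>{0..1}. f' t = g' t"
      using assms(6) f'(2) g'(2) unfolding unique_path_lifting_def by metis
    then show "\<forall>t\<in>{0..1}. f t = g t"
      using f'(1) g'(1) single unfolding coset_lift_def by metis
  qed
qed

end
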